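(* Let $d$ be a positive integer and let $f$ be a non-zero polynomial of degree $d$ (with complex coefficients) which, when expressed with respect to the polynomial basis $$B_d := \left\{ \binom{t+d-j}{d} : 0 \leq j \leq d \right\},$$ has real, non-negative coefficients; that is, $f(t)=\sum_{j=0}^{d} h_j \binom{t+d-j}{d}$ with $h_0,\dots,h_d\in\mathbb{R}_{\ge 0}$. Then every complex root $z$ of $f$ lies in the closed disc with center $-\tfrac{1}{2}$ and radius $d\left(d-\tfrac{1}{2}\right)$, i.e. $\left|z+\tfrac12\right|\le d\left(d-\tfrac12\right)$.
   Context: Here $\binom{t+d-j}{d}$ denotes the polynomial $\frac{1}{d!}(t+d-j)(t+d-j-1)\cdots(t-j+1)$ in the variable $t$, which has degree $d$; the polynomials in $B_d$ form a basis of the space of polynomials of degree at most $d$. *)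

theory Defs
  imports "HOL-Analysis.Analysis" "HOL-Computational_Algebra.Polynomial"
begin

(* The polynomial binom(t + d - j, d) in t. The factor with index i is t + d - j - i;
   the subtraction is done in the complex numbers because d - j - i may be negative. *)
definition binom_basis_poly :: "nat \<Rightarrow> nat \<Rightarrow> complex poly" where
  "binom_basis_poly d j =
     smult (1 / fact d) (\<Prod>i<d. [:of_nat d - of_nat j - of_nat i, 1:])"

lemma poly_binom_basis_poly:
  "poly (binom_basis_poly d j) t = (t + of_nat d - of_nat j) gchoose d"
  by (simp add: binom_basis_poly_def gbinomial_prod_rev poly_prod atLeast0LessThan algebra_simps)

end

(* Put w = z + 1/2. The zeros of every basis polynomial binom(t+d-j, d) lie within distance d - 1/2
   of -1/2, so its value at z is a positive multiple of w^d times a product of d factors 1 - u with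
   |u| <= (d - 1/2) / |w|. If z lay outside the disc, then |u| < 1/d, so by Jordan's inequality each
   factor would have argument less than pi / (2 d) in absolute value, and the product would have
   positive real part. A non-trivial non-negative combination of such values cannot vanish. *)
theory Submission
  imports Defs
begin

text \<open>Jordan's inequality: sine is concave on this interval, so its graph lies above the chord
  from (0, 0) to (pi/2, 1).\<close>

lemma sin_ge_two_over_pi_times:
  fixes x :: real
  assumes "0 \<le> x" "x \<le> pi / 2"
  shows "2 * x / pi \<le> sin x"
proof -
  have "concave_on {0..pi / 2} sin"
    unfolding concave_on_def
  proof (rule convex_on_realI[where f' = "\<lambda>x. - cos x"])
    fix x y :: real
    assume "x \<in> {0..pi / 2}" "y \<in> {0..pi / 2}" "x \<le> y"
    then show "- cos x \<le> - cos y"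
      by (auto intro!: cos_monotone_0_pi_le)
  qed (auto intro!: derivative_eq_intros)
  from concave_onD_Icc'[OF this, of x] assms show ?thesis
    by simp
qed

text \<open>The distance from 1 to the line through 0 and \<open>1 - u\<close> is the absolute sine
  of the argument of \<open>1 - u\<close>. It is at most the distance \<open>norm u\<close> from 1
  to \<open>1 - u\<close>, and Jordan's inequality turns this into a bound on the angle.\<close>

lemma abs_Im_Ln_one_minus_le:
  assumes "norm u < 1"
  shows "\<bar>Im (Ln (1 - u))\<bar> \<le> pi / 2 * norm u"
proof -
  let ?v = "1 - u"
  let ?a = "\<bar>Arg ?v\<bar>"
  have "Re u < 1"
    using assms complex_Re_le_cmod[of u] by linarith
  then have v: "?v \<noteq> 0" and a: "?a < pi / 2"
    using Arg_Re_pos[of ?v] by auto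
  have "(Im u)\<^sup>2 \<le> (norm u)\<^sup>2 * (norm ?v)\<^sup>2"
  proof -
    \<comment> \<open>The number \<open>cnj u * (1 - u)\<close> has real part
      \<open>Re u - (norm u)\<^sup>2\<close> and imaginary part \<open>- Im u\<close>.\<close>
    have "(norm u)\<^sup>2 * (norm ?v)\<^sup>2 - (Im u)\<^sup>2 = (Re u - (norm u)\<^sup>2)\<^sup>2"
      unfolding cmod_power2 by (simp add: algebra_simps power2_eq_square)
    then show ?thesis
      by (metis diff_ge_0_iff_ge zero_le_power2)
  qed
  then have "\<bar>Im u\<bar>\<^sup>2 \<le> (norm u * norm ?v)\<^sup>2"
    by (simp add: power_mult_distrib)
  then have "\<bar>Im u\<bar> \<le> norm u * norm ?v"
    by (rule power2_le_imp_le) simp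
  then have "\<bar>sin (Arg ?v)\<bar> \<le> norm u"
    using v by (simp add: sin_Arg pos_divide_le_eq)
  moreover have "sin ?a \<le> \<bar>sin (Arg ?v)\<bar>"
    by (simp add: abs_if)
  moreover have "2 * ?a / pi \<le> sin ?a"
    using a by (intro sin_ge_two_over_pi_times) auto
  ultimately have "2 * ?a / pi \<le> norm u"
    by linarith
  then show ?thesis
    using v by (simp add: Arg_eq_Im_Ln field_simps)
qed

lemma Re_prod_one_minus_pos:
  fixes u :: "'a \<Rightarrow> complex"
  assumes u: "\<And>i. i \<in> A \<Longrightarrow> norm (u i) < 1 / card A"
  shows "0 < Re (\<Prod>i\<in>A. 1 - u i)"
\<comment> \<open>For empty or infinite \<open>A\<close> the product is 1 by convention; the strict
  estimate of the sum below needs \<open>A\<close> finite and non-empty.\<close>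
proof (cases "finite A \<and> A \<noteq> {}")
  case True
  then have card: "card A > 0"
    by (simp add: card_gt_0_iff)
  have u1: "norm (u i) < 1" if "i \<in> A" for i
  proof -
    have "1 / real (card A) \<le> 1"
      using card by simp
    with u[OF that] show ?thesis
      by linarith
  qed
  let ?s = "\<Sum>i\<in>A. Ln (1 - u i)"
  have "1 - u i \<noteq> 0" if "i \<in> A" for i
    using u1[OF that] by auto
  then have "(\<Prod>i\<in>A. 1 - u i) = exp ?s"
    using True by (simp add: exp_sum)
  \<comment> \<open>The sign of \<open>Re (exp ?s)\<close> is that of
    \<open>cos (Im ?s)\<close>.\<close>
  moreover have "\<bar>Im ?s\<bar> < pi / 2"
  proof -
    have "\<bar>Im ?s\<bar> \<le> (\<Sum>i\<in>A. \<bar>Im (Ln (1 - u i))\<bar>)"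
      by simp
    also have "\<dots> \<le> (\<Sum>i\<in>A. pi / 2 * norm (u i))"
      using u1 by (intro sum_mono abs_Im_Ln_one_minus_le)
    also have "\<dots> < (\<Sum>i\<in>A. pi / 2 * (1 / card A))"
      using True u by (intro sum_strict_mono mult_strict_left_mono) auto
    also have "\<dots> = pi / 2"
      using card by simp
    finally show ?thesis .
  qed
  ultimately show ?thesis
    by (simp add: Re_exp cos_gt_zero_pi abs_less_iff)
qed auto

text \<open>The divisor does not depend on \<open>j\<close>, so one rotation and scaling puts all
  the basis values at \<open>z\<close> into the same open half-plane.\<close>

lemma Re_binom_basis_poly_pos:
  assumes "j \<le> d" and z: "real d * (real d - 1 / 2) < norm (z + 1 / 2)"
  shows "0 < Re (poly (binom_basis_poly d j) z / (z + 1 / 2) ^ d)"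
proof (cases "d = 0")
  case True
  then show ?thesis
    by (simp add: binom_basis_poly_def)
next
  case False
  define w where "w = z + 1 / 2"
  \<comment> \<open>The zero \<open>j + i - d\<close> of the factor with index \<open>i\<close>,
    measured from -1/2. As \<open>j\<close> runs from 0 to \<open>d\<close> and \<open>i\<close>
    from 0 to \<open>d - 1\<close>, these offsets fill a range symmetric about 0, which explains the
    centre -1/2.\<close>
  define r where "r i = real j + real i + 1 / 2 - real d" for i
  have w: "real d * (real d - 1 / 2) < norm w"
    using z by (simp add: w_def)
  moreover have "0 \<le> real d * (real d - 1 / 2)"
    using False by simp
  ultimately have "0 < norm w"
    by linarith
  then have "w \<noteq> 0"
    by simp
  have "norm (of_real (r i) / w) < 1 / card {..<d}" if "i \<in> {..<d}" for i
  proof -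
    have "real i \<le> real d - 1"
      using that by auto
    then have "\<bar>r i\<bar> \<le> real d - 1 / 2"
      using \<open>j \<le> d\<close> by (simp add: r_def abs_le_iff)
    then have "real d * \<bar>r i\<bar> \<le> real d * (real d - 1 / 2)"
      by (intro mult_left_mono) auto
    with w have "real d * \<bar>r i\<bar> < norm w"
      by linarith
    then show ?thesis
      using False \<open>0 < norm w\<close> by (simp add: norm_divide field_simps)
  qed
  then have pos: "0 < Re (\<Prod>i<d. 1 - of_real (r i) / w)"
    by (rule Re_prod_one_minus_pos)
  have factor: "z + of_nat d - of_nat j - of_nat i = w * (1 - of_real (r i) / w)" for i
    using \<open>w \<noteq> 0\<close> by (simp add: right_diff_distrib) (simp add: w_def r_def)
  have "poly (binom_basis_poly d j) z = (\<Prod>i<d. z + of_nat d - of_nat j - of_nat i) / fact d"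
    by (simp add: binom_basis_poly_def poly_prod algebra_simps)
  also have "\<dots> = w ^ d * (\<Prod>i<d. 1 - of_real (r i) / w) / fact d"
    unfolding factor by (simp add: prod.distrib)
  finally have "poly (binom_basis_poly d j) z / w ^ d
      = (\<Prod>i<d. 1 - of_real (r i) / w) / of_real (fact d)"
    using \<open>w \<noteq> 0\<close> by simp
  then show ?thesis
    using pos by (simp only: w_def Re_divide_of_real) simp
qed

theorem theorem1:
  fixes d :: nat and f :: "complex poly" and h :: "nat \<Rightarrow> real" and z :: complex
  assumes "d > 0"
    and "f \<noteq> 0"
    and "degree f = d"
    and "f = (\<Sum>j\<le>d. smult (complex_of_real (h j)) (binom_basis_poly d j))"
    and "\<And>j. j \<le> d \<Longrightarrow> h j \<ge> 0"
    and "poly f z = 0"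
  shows "z \<in> cball (- 1 / 2) (real d * (real d - 1 / 2))"
proof (rule ccontr)
  assume "z \<notin> cball (- 1 / 2) (real d * (real d - 1 / 2))"
  moreover have "dist (- 1 / 2) z = norm (z + 1 / 2)"
    by (simp add: dist_norm norm_minus_commute)
  ultimately have z: "real d * (real d - 1 / 2) < norm (z + 1 / 2)"
    by simp
  define p where "p j = Re (poly (binom_basis_poly d j) z / (z + 1 / 2) ^ d)" for j
  have p: "0 < p j" if "j \<le> d" for j
    unfolding p_def using that z by (rule Re_binom_basis_poly_pos)
  have "poly f z / (z + 1 / 2) ^ d
      = (\<Sum>j\<le>d. of_real (h j) * (poly (binom_basis_poly d j) z / (z + 1 / 2) ^ d))"
    by (simp add: assms(4) poly_sum sum_divide_distrib)
  \<comment> \<open>Each \<open>h j\<close> is real and so comes out of \<open>Re\<close>; the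
    deleted simp rule would move it into the numerator.\<close>
  then have "Re (poly f z / (z + 1 / 2) ^ d) = (\<Sum>j\<le>d. h j * p j)"
    unfolding p_def by (simp del: times_divide_eq_right)
  then have "(\<Sum>j\<le>d. h j * p j) = 0"
    using assms(6) by simp
  moreover have "0 \<le> h j * p j" if "j \<le> d" for j
    using assms(5) p that by (simp add: less_imp_le)
  ultimately have "h j * p j = 0" if "j \<le> d" for j
    using that by (subst (asm) sum_nonneg_eq_0_iff) auto
  then have "h j = 0" if "j \<le> d" for j
    using p that by fastforce
  then have "f = 0"
    unfolding assms(4) by simp
  with assms(2) show False
    by contradiction
qed

end
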